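(* Let $G$ be a graph with $n$ vertices and $m\geq 1$ edges, let $A$ be its adjacency matrix with eigenvalues $\lambda_{1} \geq \lambda_{2} \geq \ldots \geq \lambda_{n}$, let $E=\sum_{i=1}^{n}|\lambda_{i}|$ be its energy, let $t_{nz}=\min\{|\lambda_{i}| : 1\leq i\leq n,\ \lambda_{i} \neq 0\}$, and let $r=\operatorname{rank}(A)$. Then $$ E \geq \frac{2m+r\lambda_{1}t_{nz}}{\lambda_{1}+t_{nz}}. $$
   Context: Graphs are finite, simple and undirected. The adjacency matrix $A$ of a graph with $n$ vertices is the symmetric $n\times n$ matrix with entries in $\{0,1\}$ whose $(i,j)$ entry is $1$ exactly when vertices $i$ and $j$ are adjacent; its eigenvalues are listed with multiplicity. The rank of $A$ is its rank as a real matrix. *)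

theory Defs
  imports
    "HOL-Computational_Algebra.Fundamental_Theorem_Algebra"
    "Jordan_Normal_Form.Char_Poly"
    "Jordan_Normal_Form.DL_Rank"
begin

definition simple_graph :: "'a set \<Rightarrow> 'a set set \<Rightarrow> bool" where
  "simple_graph V E \<longleftrightarrow> finite V \<and> (\<forall>e\<in>E. e \<subseteq> V \<and> card e = 2)"

text \<open>The list \<open>vs\<close> enumerates the vertex set without repetition. The diagonal entries
  vanish because \<open>{v, v}\<close> does not have two elements and so is not an edge.\<close>

definition adjacency_mat :: "'a list \<Rightarrow> 'a set set \<Rightarrow> real mat" where
  "adjacency_mat vs E =
     mat (length vs) (length vs) (\<lambda>(i, j). if {vs ! i, vs ! j} \<in> E then 1 else 0)"

text \<open>The real roots of the characteristic polynomial with multiplicity, in weakly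
  decreasing order. For a symmetric matrix these are all of its eigenvalues, see
  \<open>length_eigvals\<close> below.\<close>

definition eigvals :: "real mat \<Rightarrow> real list" where
  "eigvals A = rev (sorted_list_of_multiset (proots (char_poly A)))"

text \<open>Indices start at 1: \<open>eigval A 1\<close> is the largest eigenvalue.\<close>

definition eigval :: "real mat \<Rightarrow> nat \<Rightarrow> real" where
  "eigval A i = eigvals A ! (i - 1)"

definition energy :: "real mat \<Rightarrow> real" where
  "energy A = (\<Sum>i = 1..dim_row A. \<bar>eigval A i\<bar>)"

definition min_nonzero_abs_eigval :: "real mat \<Rightarrow> real" where
  "min_nonzero_abs_eigval A =
     Min {\<bar>eigval A i\<bar> | i. 1 \<le> i \<and> i \<le> dim_row A \<and> eigval A i \<noteq> 0}"

definition mat_rank :: "real mat \<Rightarrow> nat" where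
  "mat_rank A = vec_space.rank (dim_row A) A"

lemma adjacency_mat_carrier: "adjacency_mat vs E \<in> carrier_mat (length vs) (length vs)"
  by (simp add: adjacency_mat_def)

lemma adjacency_mat_symmetric: "transpose_mat (adjacency_mat vs E) = adjacency_mat vs E"
  by (rule eq_matI) (auto simp: adjacency_mat_def insert_commute)

lemma sorted_eigvals: "sorted_wrt (\<ge>) (eigvals A)"
  by (simp add: eigvals_def sorted_wrt_rev)

lemma symmetric_char_poly_root_real:
  fixes A :: "real mat" and z :: complex
  assumes A: "A \<in> carrier_mat n n" and sym: "transpose_mat A = A"
    and z: "poly (map_poly complex_of_real (char_poly A)) z = 0"
  shows "z \<in> \<real>"
proof -
  let ?C = "map_mat complex_of_real A"
  have C: "?C \<in> carrier_mat n n" using A by simp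
  have symC: "transpose_mat ?C = ?C"
    by (metis sym map_mat_transpose)
  have "char_poly ?C = map_poly complex_of_real (char_poly A)"
    by (rule of_real_hom.char_poly_hom[OF A])
  then have "eigenvalue ?C z" using z eigenvalue_root_char_poly[OF C] by simp
  then obtain v where v: "v \<in> carrier_vec n" "v \<noteq> 0\<^sub>v n" "?C *\<^sub>v v = z \<cdot>\<^sub>v v"
    using C by (auto simp: eigenvalue_def eigenvector_def)
  let ?w = "conjugate v"
  have w: "?w \<in> carrier_vec n" using v by simp
  have Cw: "?C *\<^sub>v ?w = conjugate (?C *\<^sub>v v)"
  proof (rule eq_vecI)
    fix i assume i: "i < dim_vec (conjugate (?C *\<^sub>v v))"
    then show "(?C *\<^sub>v ?w) $ i = conjugate (?C *\<^sub>v v) $ i"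
      using A v(1) by (auto simp: scalar_prod_def)
  qed (use A in auto)
  have "z * (v \<bullet> ?w) = (?C *\<^sub>v v) \<bullet> ?w" using v(1) w by (simp add: v(3))
  also have "\<dots> = v \<bullet> (?C *\<^sub>v ?w)"
    using transpose_vec_mult_scalar[OF C v(1) w] symC C v(1) w
    by (metis comm_scalar_prod mult_mat_vec_carrier)
  also have "\<dots> = cnj z * (v \<bullet> ?w)" using v(1) w by (simp add: Cw v(3) conjugate_smult_vec)
  finally have "z * (v \<bullet> ?w) = cnj z * (v \<bullet> ?w)" .
  moreover have "v \<bullet> ?w \<noteq> 0" using v by simp
  ultimately show ?thesis by (simp add: Reals_cnj_iff)
qed

lemma size_proots_real_rooted:
  fixes p :: "real poly"
  assumes "p \<noteq> 0" and "\<And>z. poly (map_poly complex_of_real p) z = 0 \<Longrightarrow> z \<in> \<real>"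
  shows "size (proots p) = degree p"
  using assms
proof (induction "degree p" arbitrary: p)
  case 0
  then obtain c where "p = [:c:]" by (metis degree_eq_zeroE)
  then show ?case by simp
next
  case (Suc d)
  have "degree (map_poly complex_of_real p) = Suc d" using Suc(2) by simp
  then obtain z where z: "poly (map_poly complex_of_real p) z = 0"
    by (metis fundamental_theorem_of_algebra constant_degree Zero_not_Suc)
  then obtain x where x: "z = complex_of_real x" using Suc(4) by (auto elim: Reals_cases)
  have "poly p x = 0" using z x by simp
  then obtain q where q: "p = [:- x, 1:] * q" by (metis poly_eq_0_iff_dvd dvdE)
  have q0: "q \<noteq> 0" using Suc(3) q by auto
  have d: "degree p = Suc (degree q)" unfolding q using q0 by (subst degree_mult_eq) auto
  have "z \<in> \<real>" if "poly (map_poly complex_of_real q) z = 0" for z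
  proof (rule Suc(4))
    interpret of_real_poly: map_poly_comm_ring_hom complex_of_real ..
    have "map_poly complex_of_real p = map_poly complex_of_real [:- x, 1:] * map_poly complex_of_real q"
      unfolding q by (rule of_real_poly.hom_mult)
    then show "poly (map_poly complex_of_real p) z = 0" using that by simp
  qed
  then have "size (proots q) = degree q" using Suc(1)[of q] Suc(2) d q0 by simp
  moreover have "proots p = proots [:- x, 1:] + proots q" unfolding q
    by (rule proots_mult) (use q0 in auto)
  ultimately show ?case using d by simp
qed

lemma length_eigvals:
  assumes A: "A \<in> carrier_mat n n" and sym: "transpose_mat A = A"
  shows "length (eigvals A) = n"
proof -
  have "char_poly A \<noteq> 0" "degree (char_poly A) = n"
    using degree_monic_char_poly[OF A] by auto
  then have "size (proots (char_poly A)) = n"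
    using size_proots_real_rooted symmetric_char_poly_root_real[OF A sym] by metis
  then show ?thesis
    by (metis eigvals_def length_rev mset_sorted_list_of_multiset size_mset)
qed

end

theory Submission
  imports Defs "Jordan_Normal_Form.Schur_Decomposition"
begin

text \<open>
  Write \<open>M\<close> for the largest eigenvalue and \<open>t\<close> for the least nonzero absolute value of an
  eigenvalue. Every nonzero eigenvalue \<open>x\<close> satisfies \<open>t \<le> \<bar>x\<bar> \<le> M\<close>, so
  \<open>(\<bar>x\<bar> - t) * (M - \<bar>x\<bar>) \<ge> 0\<close>, that is, \<open>\<bar>x\<bar> * (M + t) \<ge> x\<^sup>2 + M * t\<close>. Summing over the
  nonzero eigenvalues bounds the energy times \<open>M + t\<close> below by the sum of the squared
  eigenvalues plus the number of nonzero eigenvalues times \<open>M * t\<close>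
  (\<open>sum_list_abs_interval_bound\<close>).

  Three facts identify the terms. All of them start from an orthogonal diagonalization
  \<open>A = P * D * P\<^sup>T\<close> (\<open>real_spectral_theorem\<close>), in which the diagonal of \<open>D\<close> lists the
  eigenvalues.

  \<^item> The rank of \<open>A\<close> is at most the number of nonzero eigenvalues, because \<open>P * D * P\<^sup>T\<close> is a
    sum of matrices of rank at most one, one for each nonzero diagonal entry of \<open>D\<close>. Only this
    inequality is needed, since \<open>M * t \<ge> 0\<close>.

  \<^item> The power sum of order \<open>k\<close> of the eigenvalues is the trace of \<open>A ^\<^sub>m k\<close>. For \<open>k = 2\<close> it
    counts the ordered pairs of adjacent vertices, which are twice as many as the edges.

  \<^item> \<open>M\<close> bounds every eigenvalue in absolute value. This needs no Perron-Frobenius theory: the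
    entries of \<open>A\<close> are nonnegative, hence so are all traces of its powers, whereas an eigenvalue
    below \<open>- M\<close> would make the power sums of large odd order negative
    (\<open>abs_le_bound_if_odd_power_sums_nonneg\<close>).
\<close>

section \<open>Orthogonal diagonalization of real symmetric matrices\<close>

text \<open>Up to scaling, a nonzero vector is the first column of an orthogonal matrix: complete it to a basis,
  apply Gram-Schmidt, which keeps the first vector, and normalize.\<close>

lemma orthogonal_completion:
  fixes v :: "real vec"
  assumes v: "v \<in> carrier_vec n" and v0: "v \<noteq> 0\<^sub>v n"
  shows "\<exists>W c. W \<in> carrier_mat n n \<and> transpose_mat W * W = 1\<^sub>m n \<and> col W 0 = c \<cdot>\<^sub>v v"
proof -
  interpret cof_vec_space n "TYPE(real)" .
  define b where "b = basis_completion v"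
  define ws where "ws = gram_schmidt n b"
  note bc = basis_completion[OF v v0, folded b_def]
  have ws: "set ws \<subseteq> carrier_vec n" "corthogonal ws" "length ws = n"
    using gram_schmidt_result[OF bc(2,4,5) ws_def] bc(6) by auto
  have npos: "0 < n" using v v0 by (cases n) auto
  obtain vs where "b = v # vs" using bc(6,7) npos by (cases b) auto
  then have hd: "ws ! 0 = v"
    using gram_schmidt_hd[OF v] ws(3) npos unfolding ws_def by (metis hd_conv_nth length_greater_0_conv)
  have wsc: "ws ! i \<in> carrier_vec n" if "i < n" for i using ws that by auto
  define c where "c i = 1 / sqrt (ws ! i \<bullet> ws ! i)" for i
  define W where "W = mat_of_cols n (map (\<lambda>i. c i \<cdot>\<^sub>v ws ! i) [0..<n])"
  have W: "W \<in> carrier_mat n n"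
    unfolding W_def using mat_of_cols_carrier(1)[of n "map _ [0..<n]"] by simp
  have colW: "col W i = c i \<cdot>\<^sub>v ws ! i" if "i < n" for i
    unfolding W_def using that wsc[OF that] by (subst col_mat_of_cols) auto
  have orth: "ws ! i \<bullet> ws ! j = 0" if "i < n" "j < n" "i \<noteq> j" for i j
    using corthogonalD[OF ws(2), of i j] ws(3) that by simp
  have pos: "ws ! i \<bullet> ws ! i > 0" if "i < n" for i
    using corthogonalD[OF ws(2), of i i] ws(3) that conjugate_square_ge_0_vec[of "ws ! i"]
    by (simp add: less_le)
  have "transpose_mat W * W = 1\<^sub>m n"
  proof (rule eq_matI)
    fix i j assume ij: "i < dim_row (1\<^sub>m n)" "j < dim_col (1\<^sub>m n)"
    then have i: "i < n" and j: "j < n" by auto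
    have "(transpose_mat W * W) $$ (i, j) = c i * c j * (ws ! i \<bullet> ws ! j)"
      using W i j wsc[OF i] wsc[OF j] by (simp add: colW)
    also have "\<dots> = (if i = j then 1 else 0)"
      using orth[OF i j] pos[OF i] by (auto simp: c_def)
    finally show "(transpose_mat W * W) $$ (i, j) = 1\<^sub>m n $$ (i, j)" using i j by simp
  qed (use W in auto)
  then show ?thesis using W colW[OF npos] hd by metis
qed

lemma symmetric_mat_eigenvector:
  fixes A :: "real mat"
  assumes A: "A \<in> carrier_mat n n" and sym: "transpose_mat A = A" and n: "n > 0"
  shows "\<exists>v e. v \<in> carrier_vec n \<and> v \<noteq> 0\<^sub>v n \<and> A *\<^sub>v v = e \<cdot>\<^sub>v v"
proof -
  have "proots (char_poly A) \<noteq> {#}"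
    using length_eigvals[OF A sym] n by (auto simp: eigvals_def)
  then obtain e where e: "e \<in># proots (char_poly A)" by auto
  moreover have "char_poly A \<noteq> 0" using degree_monic_char_poly[OF A] by auto
  ultimately have "poly (char_poly A) e = 0" by simp
  then have "eigenvalue A e" by (simp add: eigenvalue_root_char_poly[OF A])
  then show ?thesis using A by (auto simp: eigenvalue_def eigenvector_def)
qed

lemma assoc_mult_mat_conjugation:
  assumes W: "W \<in> carrier_mat n n" and X: "X \<in> carrier_mat n n" and B: "B \<in> carrier_mat n n"
    and Y: "Y \<in> carrier_mat n n" and Z: "Z \<in> carrier_mat n n"
  shows "W * (X * B * Y) * Z = (W * X) * B * (Y * (Z :: 'a::semiring_1 mat))"
proof -
  have "W * (X * B * Y) * Z = W * (X * B) * Y * Z"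
    by (simp only: assoc_mult_mat[OF W mult_carrier_mat[OF X B] Y])
  also have "\<dots> = W * X * B * Y * Z" by (simp only: assoc_mult_mat[OF W X B])
  also have "\<dots> = (W * X) * B * (Y * Z)"
    by (rule assoc_mult_mat[OF mult_carrier_mat[OF mult_carrier_mat[OF W X] B] Y Z])
  finally show ?thesis .
qed

text \<open>Induction on the dimension. An orthogonal matrix \<open>W\<close> whose first column is an eigenvector
  conjugates \<open>A\<close> into a matrix whose first column vanishes below the diagonal; by symmetry its
  first row vanishes as well, and the remaining block is symmetric again.\<close>

lemma real_spectral_theorem:
  fixes A :: "real mat"
  assumes "A \<in> carrier_mat n n" and "transpose_mat A = A"
  shows "\<exists>P D. P \<in> carrier_mat n n \<and> D \<in> carrier_mat n n \<and> diagonal_mat D \<and>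
    transpose_mat P * P = 1\<^sub>m n \<and> A = P * D * transpose_mat P"
  using assms
proof (induction n arbitrary: A)
  case 0
  show ?case
    by (rule exI[of _ "1\<^sub>m 0"], rule exI[of _ A]) (use 0 in \<open>auto simp: diagonal_mat_def\<close>)
next
  case (Suc n)
  note A = Suc.prems(1)
  obtain v e where v: "v \<in> carrier_vec (Suc n)" "v \<noteq> 0\<^sub>v (Suc n)" "A *\<^sub>v v = e \<cdot>\<^sub>v v"
    using symmetric_mat_eigenvector[OF Suc.prems] by auto
  obtain W c where W: "W \<in> carrier_mat (Suc n) (Suc n)"
    and WtW: "transpose_mat W * W = 1\<^sub>m (Suc n)" and colW: "col W 0 = c \<cdot>\<^sub>v v"
    using orthogonal_completion[OF v(1,2)] by auto
  have Wt: "transpose_mat W \<in> carrier_mat (Suc n) (Suc n)" using W by simp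
  have WWt: "W * transpose_mat W = 1\<^sub>m (Suc n)" by (rule mat_mult_left_right_inverse[OF Wt W WtW])
  define B where "B = transpose_mat W * A * W"
  have B: "B \<in> carrier_mat (Suc n) (Suc n)" unfolding B_def using A W by simp
  have symB: "transpose_mat B = B"
    unfolding B_def using A W Wt Suc.prems(2)
    by (subst transpose_mult[OF mult_carrier_mat[OF Wt A] W], subst transpose_mult[OF Wt A])
      (simp add: assoc_mult_mat[OF Wt A W])
  have AWB: "A = W * B * transpose_mat W"
  proof -
    have "W * B * transpose_mat W = (W * transpose_mat W) * A * (W * transpose_mat W)"
      unfolding B_def by (rule assoc_mult_mat_conjugation[OF W Wt A W Wt])
    then show ?thesis using A WWt by simp
  qed
  have B0: "B $$ (i, 0) = (if i = 0 then e else 0)" if i: "i < Suc n" for i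
  proof -
    have "col B 0 = transpose_mat W * A *\<^sub>v col W 0" unfolding B_def using W A by (subst col_mult2) auto
    also have "\<dots> = transpose_mat W *\<^sub>v (A *\<^sub>v (c \<cdot>\<^sub>v v))" unfolding colW using W A v(1) by simp
    also have "A *\<^sub>v (c \<cdot>\<^sub>v v) = e \<cdot>\<^sub>v col W 0"
      unfolding colW using A v by (simp add: mult_mat_vec smult_smult_assoc mult.commute)
    also have "transpose_mat W *\<^sub>v (e \<cdot>\<^sub>v col W 0) = e \<cdot>\<^sub>v col (transpose_mat W * W) 0"
      using W by (subst col_mult2[OF Wt W]) (auto intro!: mult_mat_vec)
    finally have "col B 0 $ i = (e \<cdot>\<^sub>v col (1\<^sub>m (Suc n)) 0) $ i" by (simp add: WtW)
    then show ?thesis using B i by simp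
  qed
  \<comment> \<open>the block of \<open>B\<close> that remains without its first row and column\<close>
  define C where "C = mat n n (\<lambda>(i, j). B $$ (Suc i, Suc j))"
  have C: "C \<in> carrier_mat n n" unfolding C_def by simp
  have Bsym: "B $$ (i, j) = B $$ (j, i)" if "i < Suc n" "j < Suc n" for i j
    using B symB that by (metis index_transpose_mat(1) carrier_matD)
  have symC: "transpose_mat C = C"
    by (rule eq_matI) (auto simp: C_def intro: Bsym)
  obtain P D where P: "P \<in> carrier_mat n n" and D: "D \<in> carrier_mat n n" "diagonal_mat D"
    and PtP: "transpose_mat P * P = 1\<^sub>m n" and CPD: "C = P * D * transpose_mat P"
    using Suc.IH[OF C symC] by auto
  let ?one = "1\<^sub>m 1 :: real mat"
  let ?r = "0\<^sub>m 1 n :: real mat" and ?c = "0\<^sub>m n 1 :: real mat" and ?e = "mat 1 1 (\<lambda>_. e)"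
  define P' where "P' = four_block_mat ?one ?r ?c P"
  define D' where "D' = four_block_mat ?e ?r ?c D"
  have P': "P' \<in> carrier_mat (Suc n) (Suc n)" unfolding P'_def using P by auto
  have D': "D' \<in> carrier_mat (Suc n) (Suc n)" unfolding D'_def using D by auto
  have diag: "diagonal_mat D'" using D unfolding diagonal_mat_def D'_def by auto
  have Pt: "transpose_mat P' = four_block_mat ?one ?r ?c (transpose_mat P)"
    unfolding P'_def using P by (subst transpose_four_block_mat) auto
  have BC: "B = four_block_mat ?e ?r ?c C"
  proof (rule eq_matI)
    fix i j assume "i < dim_row (four_block_mat ?e ?r ?c C)" "j < dim_col (four_block_mat ?e ?r ?c C)"
    then have ij: "i < Suc n" "j < Suc n" using C by auto
    show "B $$ (i, j) = four_block_mat ?e ?r ?c C $$ (i, j)"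
      using ij B0[of i] B0[of j] Bsym[of i j] by (cases i; cases j) (auto simp: C_def)
  qed (use B C in auto)
  have PtP': "transpose_mat P' * P' = 1\<^sub>m (Suc n)"
  proof -
    have "transpose_mat P' * P' = four_block_mat ?one ?r ?c (1\<^sub>m n)"
      unfolding Pt unfolding P'_def using P
      by (subst mult_four_block_mat[of _ 1 1 _ n _ n]) (auto simp: PtP)
    also have "\<dots> = 1\<^sub>m (Suc n)" by (rule eq_matI) auto
    finally show ?thesis .
  qed
  have PDP: "P' * D' * transpose_mat P' = B"
  proof -
    have "P' * D' = four_block_mat ?e ?r ?c (P * D)"
      unfolding P'_def D'_def using P D by (subst mult_four_block_mat[of _ 1 1 _ n _ n]) auto
    then show ?thesis unfolding Pt BC CPD using P D
      by (subst \<open>P' * D' = _\<close>, subst mult_four_block_mat[of _ 1 1 _ n _ n]) auto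
  qed
  show ?case
  proof (intro exI conjI)
    show "W * P' \<in> carrier_mat (Suc n) (Suc n)" using W P' by simp
    show "D' \<in> carrier_mat (Suc n) (Suc n)" "diagonal_mat D'" by fact+
    have t: "transpose_mat (W * P') = transpose_mat P' * transpose_mat W"
      using W P' by (rule transpose_mult)
    have Pt': "transpose_mat P' \<in> carrier_mat (Suc n) (Suc n)" using P' by simp
    have "transpose_mat (W * P') * (W * P') = transpose_mat P' * (transpose_mat W * 1\<^sub>m (Suc n) * W) * P'"
      unfolding t assoc_mult_mat_conjugation[OF Pt' Wt one_carrier_mat W P']
      using right_mult_one_mat[OF mult_carrier_mat[OF Pt' Wt]] by simp
    then show "transpose_mat (W * P') * (W * P') = 1\<^sub>m (Suc n)"
      by (simp only: right_mult_one_mat[OF Wt] WtW right_mult_one_mat[OF Pt'] PtP')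
    have "W * P' * D' * transpose_mat (W * P') = W * (P' * D' * transpose_mat P') * transpose_mat W"
      unfolding t by (rule assoc_mult_mat_conjugation[OF W P' D' Pt' Wt, symmetric])
    then show "A = W * P' * D' * transpose_mat (W * P')" unfolding PDP using AWB by simp
  qed
qed

section \<open>Rank, spectrum and power sums of a diagonalized matrix\<close>

lemma rank_le_nonzero_diagonal:
  fixes P D Q :: "'a::field mat"
  assumes P: "P \<in> carrier_mat n n" and D: "D \<in> carrier_mat n n" "diagonal_mat D"
    and Q: "Q \<in> carrier_mat n n"
  shows "vec_space.rank n (P * D * Q) \<le> card {i. i < n \<and> D $$ (i, i) \<noteq> 0}"
proof -
  interpret vec_space "TYPE('a)" n .
  \<comment> \<open>partial sums of the expansion of \<open>P * D * Q\<close> into matrices of rank at most one\<close>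
  define M where "M k = mat n n (\<lambda>(i, j). \<Sum>l<k. P $$ (i, l) * D $$ (l, l) * Q $$ (l, j))" for k
  have M: "M k \<in> carrier_mat n n" for k by (simp add: M_def)
  have "rank (M k) \<le> card {i. i < k \<and> D $$ (i, i) \<noteq> 0}" for k
  proof (induction k)
    case 0
    have "M 0 = 0\<^sub>m n n" by (rule eq_matI) (auto simp: M_def)
    then show ?case by (simp add: rank_0I)
  next
    case (Suc k)
    show ?case
    proof (cases "D $$ (k, k) = 0")
      case True
      have "M (Suc k) = M k" by (rule eq_matI) (auto simp: M_def True)
      moreover have "{i. i < Suc k \<and> D $$ (i, i) \<noteq> 0} = {i. i < k \<and> D $$ (i, i) \<noteq> 0}"
        using True less_Suc_eq by auto
      ultimately show ?thesis using Suc by simp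
    next
      case False
      define R where "R = mat n n (\<lambda>(i, j). P $$ (i, k) * (D $$ (k, k) * Q $$ (k, j)))"
      have R: "R \<in> carrier_mat n n" by (simp add: R_def)
      have "M (Suc k) = M k + R" by (rule eq_matI) (auto simp: M_def R_def mult.assoc)
      then have "rank (M (Suc k)) \<le> rank (M k) + rank R" using rank_subadditive[OF M R] by simp
      moreover have "rank R \<le> 1"
        by (rule rank_le_1_product_entries[OF R, of "\<lambda>i. P $$ (i, k)" "\<lambda>j. D $$ (k, k) * Q $$ (k, j)"])
          (auto simp: R_def)
      moreover have "{i. i < Suc k \<and> D $$ (i, i) \<noteq> 0} = insert k {i. i < k \<and> D $$ (i, i) \<noteq> 0}"
        using False less_Suc_eq by auto
      ultimately show ?thesis using Suc by simp
    qed
  qed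
  moreover have "P * D * Q = M n"
  proof (rule eq_matI)
    fix i j assume "i < dim_row (M n)" "j < dim_col (M n)"
    then have ij: "i < n" "j < n" by (auto simp: M_def)
    have PD: "(P * D) $$ (i, l) = P $$ (i, l) * D $$ (l, l)" if l: "l < n" for l
    proof -
      have "(P * D) $$ (i, l) = (\<Sum>k<n. P $$ (i, k) * D $$ (k, l))"
        using P D ij l by (simp add: scalar_prod_def atLeast0LessThan)
      also have "\<dots> = (\<Sum>k<n. if k = l then P $$ (i, l) * D $$ (l, l) else 0)"
        using D l by (intro sum.cong) (auto simp: diagonal_mat_def)
      finally show ?thesis using l by simp
    qed
    have "(P * D * Q) $$ (i, j) = (\<Sum>l<n. row (P * D) i $ l * col Q j $ l)"
      using P D Q ij by (subst index_mult_mat(1)) (auto simp: scalar_prod_def atLeast0LessThan)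
    also have "\<dots> = (\<Sum>l<n. (P * D) $$ (i, l) * Q $$ (l, j))"
      using P D(1) Q ij by (intro sum.cong arg_cong2[of _ _ _ _ "(*)"]) (simp_all add: row_def)
    also have "\<dots> = M n $$ (i, j)" using PD ij by (simp add: M_def)
    finally show "(P * D * Q) $$ (i, j) = M n $$ (i, j)" .
  qed (use P D Q in \<open>auto simp: M_def\<close>)
  ultimately show ?thesis by simp
qed

lemma mset_eigvals_diagonalization:
  fixes A :: "real mat"
  assumes wit: "similar_mat_wit A D P Q" and D: "D \<in> carrier_mat n n" "diagonal_mat D"
  shows "mset (eigvals A) = mset (diag_mat D)"
proof -
  have "char_poly A = char_poly D"
    using wit by (intro char_poly_similar) (auto simp: similar_mat_def)
  also have "\<dots> = (\<Prod>a\<leftarrow>diag_mat D. [:- a, 1:])"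
    using D by (intro char_poly_upper_triangular[of _ n]) (auto simp: diagonal_mat_def)
  finally have cp: "char_poly A = (\<Prod>a\<leftarrow>diag_mat D. [:- a, 1:])" .
  have "proots (\<Prod>a\<leftarrow>xs. [:- a, 1:]) = mset xs" for xs :: "real list"
  proof (induction xs)
    case (Cons a xs)
    have "(\<Prod>a\<leftarrow>xs. [:- a, 1:]) \<noteq> 0" by (auto simp: prod_list_zero_iff)
    then have "proots ([:- a, 1:] * (\<Prod>a\<leftarrow>xs. [:- a, 1:])) =
        proots [:- a, 1:] + proots (\<Prod>a\<leftarrow>xs. [:- a, 1:])"
      by (intro proots_mult) auto
    then show ?case using Cons by simp
  qed simp
  then show ?thesis by (simp add: eigvals_def cp)
qed

lemma sum_diagonal_mult_commute:
  fixes X Y :: "'a::comm_semiring_0 mat"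
  assumes "X \<in> carrier_mat n n" "Y \<in> carrier_mat n n"
  shows "(\<Sum>i<n. (X * Y) $$ (i, i)) = (\<Sum>i<n. (Y * X) $$ (i, i))"
proof -
  have "(\<Sum>i<n. (X * Y) $$ (i, i)) = (\<Sum>i<n. \<Sum>j<n. X $$ (i, j) * Y $$ (j, i))"
    using assms by (simp add: scalar_prod_def atLeast0LessThan)
  also have "\<dots> = (\<Sum>j<n. \<Sum>i<n. Y $$ (j, i) * X $$ (i, j))"
    by (subst sum.swap) (simp add: mult.commute)
  also have "\<dots> = (\<Sum>i<n. (Y * X) $$ (i, i))"
    using assms by (simp add: scalar_prod_def atLeast0LessThan)
  finally show ?thesis .
qed

lemma diagonal_mat_pow:
  fixes D :: "'a::comm_semiring_1 mat"
  assumes D: "D \<in> carrier_mat n n" "diagonal_mat D"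
  shows "D ^\<^sub>m k = mat n n (\<lambda>(i, j). if i = j then D $$ (i, i) ^ k else 0)"
proof (induction k)
  case 0
  show ?case using D by (intro eq_matI) auto
next
  case (Suc k)
  show ?case
  proof (rule eq_matI)
    fix i j
    assume "i < dim_row (mat n n (\<lambda>(i, j). if i = j then D $$ (i, i) ^ Suc k else 0))"
      and "j < dim_col (mat n n (\<lambda>(i, j). if i = j then D $$ (i, i) ^ Suc k else 0))"
    then have ij: "i < n" "j < n" by auto
    have "(D ^\<^sub>m Suc k) $$ (i, j) = (\<Sum>l<n. (if i = l then D $$ (i, i) ^ k else 0) * D $$ (l, j))"
      using D ij by (simp add: Suc scalar_prod_def atLeast0LessThan)
    also have "\<dots> = (\<Sum>l<n. if l = i then D $$ (i, i) ^ k * D $$ (i, j) else 0)"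
      by (intro sum.cong) auto
    also have "\<dots> = (if i = j then D $$ (i, i) ^ Suc k else 0)"
      using D ij by (auto simp: diagonal_mat_def mult.commute)
    finally show "(D ^\<^sub>m Suc k) $$ (i, j) =
        mat n n (\<lambda>(i, j). if i = j then D $$ (i, i) ^ Suc k else 0) $$ (i, j)"
      using ij by simp
  qed (use D in auto)
qed

lemma sum_diagonal_pow_diagonalization:
  fixes A :: "'a::comm_ring_1 mat"
  assumes A: "A \<in> carrier_mat n n" and wit: "similar_mat_wit A D P Q" and diag: "diagonal_mat D"
  shows "(\<Sum>i<n. (A ^\<^sub>m k) $$ (i, i)) = (\<Sum>x\<leftarrow>diag_mat D. x ^ k)"
proof -
  note w = similar_mat_witD2[OF A wit]
  have Dk: "D ^\<^sub>m k \<in> carrier_mat n n" using w by simp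
  have "(\<Sum>i<n. (A ^\<^sub>m k) $$ (i, i)) = (\<Sum>i<n. (P * (D ^\<^sub>m k * Q)) $$ (i, i))"
    unfolding similar_mat_wit_pow_id[OF wit] using w Dk by (subst assoc_mult_mat) auto
  also have "\<dots> = (\<Sum>i<n. (D ^\<^sub>m k * Q * P) $$ (i, i))"
    using w Dk by (intro sum_diagonal_mult_commute) auto
  also have "D ^\<^sub>m k * Q * P = D ^\<^sub>m k" using w Dk by (simp add: assoc_mult_mat[of _ n n _ n _ n])
  also have "(\<Sum>i<n. (D ^\<^sub>m k) $$ (i, i)) = (\<Sum>i<n. D $$ (i, i) ^ k)"
    using w by (simp add: diagonal_mat_pow[OF _ diag])
  also have "\<dots> = (\<Sum>x\<leftarrow>diag_mat D. x ^ k)"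
    using w by (simp add: diag_mat_def o_def interv_sum_list_conv_sum_set_nat atLeast0LessThan)
  finally show ?thesis .
qed

section \<open>Absolute values of eigenvalues\<close>

lemma pow_mat_nonneg:
  fixes A :: "real mat"
  assumes A: "A \<in> carrier_mat n n" and nonneg: "\<And>i j. i < n \<Longrightarrow> j < n \<Longrightarrow> A $$ (i, j) \<ge> 0"
    and "i < n" "j < n"
  shows "(A ^\<^sub>m k) $$ (i, j) \<ge> 0"
  using assms(3,4)
proof (induction k arbitrary: i j)
  case (Suc k)
  have "(A ^\<^sub>m Suc k) $$ (i, j) = (\<Sum>l<n. (A ^\<^sub>m k) $$ (i, l) * A $$ (l, j))"
    using A Suc.prems by (simp add: scalar_prod_def atLeast0LessThan)
  also have "\<dots> \<ge> 0" using Suc nonneg by (intro sum_nonneg mult_nonneg_nonneg) auto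
  finally show ?case .
qed (use A in auto)

text \<open>A number \<open>y < - M\<close> in the list would dominate the odd power sums: the other numbers
  contribute at most \<open>length xs * max M 0 ^ k\<close>, which \<open>\<bar>y\<bar> ^ k\<close> exceeds for large \<open>k\<close>.\<close>

lemma abs_le_bound_if_odd_power_sums_nonneg:
  fixes xs :: "real list"
  assumes sums: "\<And>k. odd k \<Longrightarrow> (\<Sum>x\<leftarrow>xs. x ^ k) \<ge> 0"
    and ub: "\<And>x. x \<in> set xs \<Longrightarrow> x \<le> M" and y: "y \<in> set xs"
  shows "\<bar>y\<bar> \<le> M"
proof (rule ccontr)
  assume "\<not> \<bar>y\<bar> \<le> M"
  with ub[OF y] have yneg: "y < 0" and yM: "M < - y" by auto
  \<comment> \<open>\<open>M\<close> may be negative, while \<open>K / - y\<close> lies in the range where powers tend to 0\<close>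
  define K where "K = max M 0"
  have K: "0 \<le> K" "K / - y < 1" using yneg yM by (auto simp: K_def field_simps)
  have bound: "(\<Sum>x\<leftarrow>xs. x ^ k) \<le> real (length xs) * K ^ k + y ^ k" if k: "odd k" for k
  proof -
    have le: "x ^ k \<le> K ^ k" if "x \<in> set xs" for x
      using k ub[OF that] by (intro power_mono_odd) (auto simp: K_def)
    have "(\<Sum>x\<leftarrow>xs. x ^ k) = y ^ k + (\<Sum>x\<leftarrow>remove1 y xs. x ^ k)"
      by (rule sum_list_map_remove1[OF y])
    also have "(\<Sum>x\<leftarrow>remove1 y xs. x ^ k) \<le> (\<Sum>x\<leftarrow>remove1 y xs. K ^ k)"
      using le set_remove1_subset[of y xs] by (intro sum_list_mono) blast
    also have "(\<Sum>x\<leftarrow>remove1 y xs. K ^ k) \<le> real (length xs) * K ^ k"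
      using K by (simp add: sum_list_triv length_remove1 mult_right_mono)
    finally show ?thesis by simp
  qed
  have "(\<lambda>k. (K / - y) ^ k) \<longlonglongrightarrow> 0"
    by (rule LIMSEQ_realpow_zero[OF divide_nonneg_pos K(2)]) (use K yneg in simp_all)
  then have "(\<lambda>k. real (length xs) * (K / - y) ^ k) \<longlonglongrightarrow> real (length xs) * 0"
    by (rule tendsto_mult_left)
  then have "\<forall>\<^sub>F k in sequentially. real (length xs) * (K / - y) ^ k < 1"
    by (rule order_tendstoD) simp
  then obtain N where N: "real (length xs) * (K / - y) ^ k < 1" if "k \<ge> N" for k
    by (auto simp: eventually_sequentially)
  define k where "k = 2 * N + 1"
  have k: "odd k" "k \<ge> N" by (auto simp: k_def)
  have "real (length xs) * K ^ k < (- y) ^ k"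
    using N[OF k(2)] yneg unfolding power_divide times_divide_eq_right
    by (subst (asm) pos_divide_less_eq) simp_all
  then have "(\<Sum>x\<leftarrow>xs. x ^ k) < 0" using bound[OF k(1)] k(1) by simp
  then show False using sums[OF k(1)] by simp
qed

section \<open>Counting edges\<close>

lemma adjacency_mat_entry_sum:
  assumes simple: "simple_graph V E" and dist: "distinct vs" and vs: "set vs = V"
  shows "(\<Sum>i<length vs. \<Sum>j<length vs. adjacency_mat vs E $$ (i, j)) = 2 * real (card E)"
proof -
  let ?n = "length vs"
  let ?S = "{(i, j). i < ?n \<and> j < ?n \<and> {vs ! i, vs ! j} \<in> E}"
  \<comment> \<open>the two orientations of the edge \<open>e\<close>\<close>
  let ?T = "\<lambda>e. {(u, w). {u, w} = e}"
  have E: "e \<subseteq> V" "card e = 2" if "e \<in> E" for e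
    using simple that by (auto simp: simple_graph_def)
  have "finite E" using simple by (auto simp: simple_graph_def intro: finite_subset[of E "Pow V"])
  have T: "finite (?T e) \<and> card (?T e) = 2" if e: "e \<in> E" for e
  proof -
    obtain a b where ab: "e = {a, b}" "a \<noteq> b" using E(2)[OF e] by (auto simp: card_2_iff)
    then have "?T e = {(a, b), (b, a)}" by (auto simp: doubleton_eq_iff)
    then show ?thesis using ab by simp
  qed
  have bij: "bij_betw (map_prod ((!) vs) ((!) vs)) ?S (\<Union>e\<in>E. ?T e)"
    unfolding bij_betw_def
  proof
    show "inj_on (map_prod ((!) vs) ((!) vs)) ?S"
      using dist by (auto simp: inj_on_def nth_eq_iff_index_eq)
    show "map_prod ((!) vs) ((!) vs) ` ?S = (\<Union>e\<in>E. ?T e)"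
    proof (intro equalityI subsetI)
      fix p assume "p \<in> (\<Union>e\<in>E. ?T e)"
      then obtain u w where p: "p = (u, w)" "{u, w} \<in> E" by auto
      then have "u \<in> set vs" "w \<in> set vs" using E(1) vs by auto
      then obtain i j where "i < ?n" "j < ?n" "u = vs ! i" "w = vs ! j"
        by (auto simp: in_set_conv_nth)
      then show "p \<in> map_prod ((!) vs) ((!) vs) ` ?S" using p by (force simp: image_iff)
    qed auto
  qed
  have "(\<Sum>i<?n. \<Sum>j<?n. adjacency_mat vs E $$ (i, j)) =
      (\<Sum>p\<in>{..<?n} \<times> {..<?n}. if p \<in> ?S then 1 else 0)"
    unfolding sum.cartesian_product by (intro sum.cong) (auto simp: adjacency_mat_def split: if_splits)
  also have "\<dots> = (\<Sum>p\<in>({..<?n} \<times> {..<?n}) \<inter> ?S. 1)"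
    by (rule sum.inter_restrict[symmetric]) simp
  also have "({..<?n} \<times> {..<?n}) \<inter> ?S = ?S" by auto
  also have "(\<Sum>p\<in>?S. 1) = real (card ?S)" by simp
  also have "card ?S = card (\<Union>e\<in>E. ?T e)" using bij by (rule bij_betw_same_card)
  also have "\<dots> = (\<Sum>e\<in>E. card (?T e))"
    using \<open>finite E\<close> T by (intro card_UN_disjoint) auto
  also have "\<dots> = 2 * card E" using T by simp
  finally show ?thesis by simp
qed

text \<open>The entries of the adjacency matrix are 0 and 1, so they equal their squares, and the trace of
  the squared matrix is the sum of all entries.\<close>

lemma adjacency_mat_square_diagonal_sum:
  assumes "simple_graph V E" and "distinct vs" and "set vs = V"
  shows "(\<Sum>i<length vs. (adjacency_mat vs E ^\<^sub>m 2) $$ (i, i)) = 2 * real (card E)"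
proof -
  let ?A = "adjacency_mat vs E"
  have A: "?A \<in> carrier_mat (length vs) (length vs)" by (rule adjacency_mat_carrier)
  have "(?A ^\<^sub>m 2) $$ (i, i) = (\<Sum>j<length vs. ?A $$ (i, j))" if i: "i < length vs" for i
  proof -
    have "(?A ^\<^sub>m 2) $$ (i, i) = (\<Sum>j<length vs. ?A $$ (i, j) * ?A $$ (j, i))"
      using A i by (simp add: numeral_2_eq_2 scalar_prod_def atLeast0LessThan)
    also have "\<dots> = (\<Sum>j<length vs. ?A $$ (i, j))"
      using i by (intro sum.cong) (auto simp: adjacency_mat_def insert_commute)
    finally show ?thesis .
  qed
  then show ?thesis using adjacency_mat_entry_sum[OF assms] by simp
qed

section \<open>The energy bound\<close>

lemma energy_eq_sum_list:
  assumes A: "A \<in> carrier_mat n n" and sym: "transpose_mat A = A"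
  shows "energy A = (\<Sum>x\<leftarrow>eigvals A. \<bar>x\<bar>)"
proof -
  have "energy A = (\<Sum>i<n. \<bar>eigvals A ! i\<bar>)"
    unfolding energy_def eigval_def using A
    by (intro sum.reindex_bij_witness[of _ Suc "\<lambda>i. i - 1"]) auto
  then show ?thesis
    using length_eigvals[OF A sym] by (simp add: sum_list_sum_nth atLeast0LessThan)
qed

lemma min_nonzero_abs_eigval_eq_Min:
  assumes A: "A \<in> carrier_mat n n" and sym: "transpose_mat A = A"
  shows "min_nonzero_abs_eigval A = Min (abs ` (set (eigvals A) - {0}))"
proof -
  have "{\<bar>eigval A i\<bar> | i. 1 \<le> i \<and> i \<le> dim_row A \<and> eigval A i \<noteq> 0} = abs ` (set (eigvals A) - {0})"
  proof (intro equalityI subsetI)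
    fix x assume "x \<in> {\<bar>eigval A i\<bar> | i. 1 \<le> i \<and> i \<le> dim_row A \<and> eigval A i \<noteq> 0}"
    then obtain i where "x = \<bar>eigval A i\<bar>" "1 \<le> i" "i \<le> n" "eigval A i \<noteq> 0" using A by auto
    then show "x \<in> abs ` (set (eigvals A) - {0})"
      using length_eigvals[OF A sym] by (auto simp: eigval_def)
  next
    fix x assume "x \<in> abs ` (set (eigvals A) - {0})"
    then obtain j where "j < n" "x = \<bar>eigvals A ! j\<bar>" "eigvals A ! j \<noteq> 0"
      using length_eigvals[OF A sym] by (metis DiffD1 DiffD2 imageE in_set_conv_nth singletonI)
    then show "x \<in> {\<bar>eigval A i\<bar> | i. 1 \<le> i \<and> i \<le> dim_row A \<and> eigval A i \<noteq> 0}"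
      using A by (auto simp: eigval_def intro!: exI[of _ "Suc j"])
  qed
  then show ?thesis by (simp add: min_nonzero_abs_eigval_def)
qed

lemma eigvals_le_eigval_1:
  assumes "x \<in> set (eigvals A)"
  shows "x \<le> eigval A 1"
  using assms sorted_eigvals[of A] by (cases "eigvals A") (auto simp: eigval_def)

text \<open>The elements 0 contribute nothing to either side; the others contribute
  \<open>(\<bar>x\<bar> - t) * (M - \<bar>x\<bar>) \<ge> 0\<close> to the difference.\<close>

lemma sum_list_abs_interval_bound:
  fixes xs :: "real list"
  assumes "\<And>x. x \<in> set xs \<Longrightarrow> x \<noteq> 0 \<Longrightarrow> t \<le> \<bar>x\<bar> \<and> \<bar>x\<bar> \<le> M"
  shows "(\<Sum>x\<leftarrow>xs. x\<^sup>2) + real (length (filter (\<lambda>x. x \<noteq> 0) xs)) * M * t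
    \<le> (\<Sum>x\<leftarrow>xs. \<bar>x\<bar>) * (M + t)"
  using assms
proof (induction xs)
  case (Cons x xs)
  have "x\<^sup>2 + (if x \<noteq> 0 then M * t else 0) \<le> \<bar>x\<bar> * (M + t)"
  proof (cases "x = 0")
    case False
    then have "0 \<le> (\<bar>x\<bar> - t) * (M - \<bar>x\<bar>)" using Cons.prems[of x] by simp
    also have "\<dots> = \<bar>x\<bar> * (M + t) - \<bar>x\<bar>\<^sup>2 - M * t" by (simp add: algebra_simps power2_eq_square)
    finally show ?thesis using False by simp
  qed simp
  then show ?case using Cons.IH Cons.prems by (auto simp: algebra_simps split: if_splits)
qed simp

theorem theorem3p6:
  fixes V :: "'a set" and E :: "'a set set" and vs :: "'a list" and n m r :: nat
    and A :: "real mat" and t\<^sub>n\<^sub>z :: real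
  assumes "simple_graph V E" and "card V = n" and "card E = m" and "m \<ge> 1"
    and "distinct vs" and "set vs = V"
    and "A = adjacency_mat vs E"
    and "t\<^sub>n\<^sub>z = min_nonzero_abs_eigval A" and "r = mat_rank A"
  shows "energy A \<ge> (2 * real m + real r * eigval A 1 * t\<^sub>n\<^sub>z) / (eigval A 1 + t\<^sub>n\<^sub>z)"
proof -
  define N where "N = length vs"
  have A: "A \<in> carrier_mat N N" using assms by (simp add: N_def adjacency_mat_carrier)
  have sym: "transpose_mat A = A" using assms by (simp add: adjacency_mat_symmetric)
  obtain P D where P: "P \<in> carrier_mat N N" and D: "D \<in> carrier_mat N N" "diagonal_mat D"
    and PtP: "transpose_mat P * P = 1\<^sub>m N" and APD: "A = P * D * transpose_mat P"
    using real_spectral_theorem[OF A sym] by blast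
  have Pt: "transpose_mat P \<in> carrier_mat N N" using P by simp
  have wit: "similar_mat_wit A D P (transpose_mat P)"
    using mat_mult_left_right_inverse[OF Pt P PtP] PtP APD A D(1) P Pt by (rule similar_mat_witI)
  have spec: "mset (eigvals A) = mset (diag_mat D)"
    by (rule mset_eigvals_diagonalization[OF wit D])
  have sum_eigvals: "(\<Sum>x\<leftarrow>eigvals A. f x) = (\<Sum>x\<leftarrow>diag_mat D. f x)" for f :: "real \<Rightarrow> real"
    by (metis mset_map spec sum_mset_sum_list)
  have power_sum: "(\<Sum>x\<leftarrow>eigvals A. x ^ k) = (\<Sum>i<N. (A ^\<^sub>m k) $$ (i, i))" for k
    by (simp add: sum_eigvals sum_diagonal_pow_diagonalization[OF A wit D(2)])
  have sum_sq: "(\<Sum>x\<leftarrow>eigvals A. x\<^sup>2) = 2 * real m"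
    unfolding power_sum using adjacency_mat_square_diagonal_sum[OF assms(1,5,6)] assms(3,7)
    by (simp add: N_def)
  have rank: "r \<le> length (filter (\<lambda>x. x \<noteq> 0) (eigvals A))"
  proof -
    have "r \<le> card {i. i < N \<and> D $$ (i, i) \<noteq> 0}"
      using rank_le_nonzero_diagonal[OF P D Pt] A assms(9) by (simp add: mat_rank_def flip: APD)
    also have "\<dots> = length (filter (\<lambda>x. x \<noteq> 0) (diag_mat D))"
      using D(1) by (auto simp: length_filter_conv_card diag_mat_def intro!: arg_cong[of _ _ card])
    also have "\<dots> = length (filter (\<lambda>x. x \<noteq> 0) (eigvals A))"
      by (metis mset_filter size_mset spec)
    finally show ?thesis .
  qed
  have abs_le: "\<bar>x\<bar> \<le> eigval A 1" if "x \<in> set (eigvals A)" for x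
  proof (rule abs_le_bound_if_odd_power_sums_nonneg[OF _ eigvals_le_eigval_1 that])
    fix k :: nat
    show "(\<Sum>x\<leftarrow>eigvals A. x ^ k) \<ge> 0"
      unfolding power_sum using assms(7)
      by (intro sum_nonneg pow_mat_nonneg[OF A]) (auto simp: adjacency_mat_def N_def)
  qed
  let ?S = "abs ` (set (eigvals A) - {0})"
  \<comment> \<open>as there is an edge, the minimum in the definition of \<open>t\<^sub>n\<^sub>z\<close> is over a nonempty set\<close>
  have "\<exists>x\<in>set (eigvals A). x \<noteq> 0"
  proof (rule ccontr)
    assume "\<not> ?thesis"
    then have "map (\<lambda>x. x\<^sup>2) (eigvals A) = map (\<lambda>x. 0) (eigvals A)" by (intro map_cong) auto
    then have "(\<Sum>x\<leftarrow>eigvals A. x\<^sup>2) = 0" by (simp only: sum_list_0)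
    then show False using sum_sq assms(4) by simp
  qed
  then have S: "finite ?S" "?S \<noteq> {}" by auto
  have t: "t\<^sub>n\<^sub>z = Min ?S" using min_nonzero_abs_eigval_eq_Min[OF A sym] assms(8) by simp
  then have "t\<^sub>n\<^sub>z \<in> ?S" using Min_in[OF S] by simp
  then have pos: "t\<^sub>n\<^sub>z > 0" "eigval A 1 > 0" using abs_le by force+
  have "2 * real m + real r * (eigval A 1 * t\<^sub>n\<^sub>z)
      \<le> (\<Sum>x\<leftarrow>eigvals A. x\<^sup>2) + real (length (filter (\<lambda>x. x \<noteq> 0) (eigvals A))) * (eigval A 1 * t\<^sub>n\<^sub>z)"
    unfolding sum_sq using rank pos by (intro add_left_mono mult_right_mono) auto
  also have "\<dots> \<le> (\<Sum>x\<leftarrow>eigvals A. \<bar>x\<bar>) * (eigval A 1 + t\<^sub>n\<^sub>z)"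
    unfolding mult.assoc[symmetric]
    by (rule sum_list_abs_interval_bound) (use abs_le S t in auto)
  also have "(\<Sum>x\<leftarrow>eigvals A. \<bar>x\<bar>) = energy A" by (simp add: energy_eq_sum_list[OF A sym])
  finally show ?thesis using pos by (simp add: divide_le_eq mult.assoc)
qed

end
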